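(* Suppose that $r_n\to\infty$ almost surely. Then, for every $A\in\mathcal{T}$, $\mathbb{P}(A)\in\{0,1\}$.
   Context: Let $Z, Z_1, Z_2, \ldots$ be i.i.d. random variables in $\mathbb{R}^2$, and let $S_0 := \mathbf{0}$ (the origin) and $S_n := \sum_{k=1}^n Z_k$ for $n \ge 1$. Let $\mathcal{H}_n$ be the convex hull of $\{S_0, \ldots, S_n\}$. Let $\mathcal{K}$ be the set of compact convex subsets of $\mathbb{R}^2$ containing the origin, endowed with the Hausdorff metric $\rho_H(K_1,K_2) = \inf\{\varepsilon\ge 0 : K_1\subseteq K_2^\varepsilon \text{ and } K_2\subseteq K_1^\varepsilon\}$, where $K^\varepsilon := \{\mathbf{x}\in\mathbb{R}^2 : \inf_{\mathbf{y}\in K}\|\mathbf{x}-\mathbf{y}\|\le\varepsilon\}$, and with the Borel $\sigma$-algebra generated by this metric; $\mathcal{H}_n$ is then a $\mathcal{K}$-valued random variable. For $n\ge 0$ set $\mathcal{T}_n := \sigma(\mathcal{H}_n,\mathcal{H}_{n+1},\ldots)$, and let $\mathcal{T} := \bigcap_{n\ge 0}\mathcal{T}_n$. For $n\ge 0$ define $r_n := \inf\{\|\mathbf{x}\| : \mathbf{x}\in\mathbb{R}^2\setminus\mathcal{H}_n\}$. Here $\|\cdot\|$ is the Euclidean norm. *)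

theory Defs
  imports "HOL-Probability.Probability"
begin

section \<open>The metric space of planar compact convex sets containing the origin\<close>

typedef cbody = "{K :: (real^2) set. compact K \<and> convex K \<and> 0 \<in> K}"
  morphisms set_of Abs_cbody
  by (intro exI[of _ "{0}"]) auto

lemma set_of_props: "compact (set_of K)" "convex (set_of K)" "0 \<in> set_of K" "set_of K \<noteq> {}"
  using set_of[of K] by auto

definition thicken :: "(real^2) set \<Rightarrow> real \<Rightarrow> (real^2) set" where
  "thicken K \<epsilon> = {x. (INF y\<in>K. norm (x - y)) \<le> \<epsilon>}"

definition hausdorff_dist :: "(real^2) set \<Rightarrow> (real^2) set \<Rightarrow> real" where
  "hausdorff_dist K L = Inf {\<epsilon>. 0 \<le> \<epsilon> \<and> K \<subseteq> thicken L \<epsilon> \<and> L \<subseteq> thicken K \<epsilon>}"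

lemma thicken_infdist: "K \<noteq> {} \<Longrightarrow> thicken K \<epsilon> = {x. infdist x K \<le> \<epsilon>}"
  by (simp add: thicken_def infdist_def dist_norm)

lemma hausdorff_dist_least:
  assumes "0 \<le> \<epsilon>" "set_of K \<subseteq> thicken (set_of L) \<epsilon>" "set_of L \<subseteq> thicken (set_of K) \<epsilon>"
  shows "hausdorff_dist (set_of K) (set_of L) \<le> \<epsilon>"
  unfolding hausdorff_dist_def by (intro cInf_lower bdd_belowI[of _ 0]) (use assms in auto)

lemma hausdorff_dist_nonempty:
  "{\<epsilon>. 0 \<le> \<epsilon> \<and> set_of K \<subseteq> thicken (set_of L) \<epsilon> \<and> set_of L \<subseteq> thicken (set_of K) \<epsilon>} \<noteq> {}"
proof -
  have "bounded (set_of K \<union> set_of L)"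
    by (simp add: set_of_props compact_imp_bounded)
  then obtain B where B: "0 < B" "\<And>x. x \<in> set_of K \<union> set_of L \<Longrightarrow> norm x \<le> B"
    by (metis bounded_pos)
  have *: "infdist x (set_of J) \<le> B" if "x \<in> set_of K \<union> set_of L" for x J
    using infdist_le[OF set_of_props(3), of x J] B(2)[OF that] by (auto simp: dist_norm)
  have "B \<in> {\<epsilon>. 0 \<le> \<epsilon> \<and> set_of K \<subseteq> thicken (set_of L) \<epsilon> \<and> set_of L \<subseteq> thicken (set_of K) \<epsilon>}"
    using * B(1) by (auto simp: thicken_infdist set_of_props)
  then show ?thesis by blast
qed

lemma hausdorff_dist_nonneg: "0 \<le> hausdorff_dist (set_of K) (set_of L)"
  unfolding hausdorff_dist_def by (rule cInf_greatest[OF hausdorff_dist_nonempty]) auto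

lemma hausdorff_dist_commute: "hausdorff_dist K L = hausdorff_dist L K"
  unfolding hausdorff_dist_def by (metis (no_types, opaque_lifting))

lemma infdist_le_hausdorff_dist:
  assumes "x \<in> set_of K"
  shows "infdist x (set_of L) \<le> hausdorff_dist (set_of K) (set_of L)"
  unfolding hausdorff_dist_def
  by (rule cInf_greatest[OF hausdorff_dist_nonempty])
     (use assms in \<open>auto simp: thicken_infdist set_of_props\<close>)

instantiation cbody :: metric_space
begin

definition dist_cbody :: "cbody \<Rightarrow> cbody \<Rightarrow> real" where
  "dist_cbody K L = hausdorff_dist (set_of K) (set_of L)"

definition uniformity_cbody :: "(cbody \<times> cbody) filter" where
  "uniformity_cbody = (INF e\<in>{0<..}. principal {(x, y). dist x y < e})"

definition open_cbody :: "cbody set \<Rightarrow> bool" where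
  "open_cbody U \<longleftrightarrow> (\<forall>x\<in>U. \<forall>\<^sub>F (x', y) in uniformity. x' = x \<longrightarrow> y \<in> U)"

instance
proof
  fix K L J :: cbody
  show "(dist K L = 0) = (K = L)"
  proof
    assume 0: "dist K L = 0"
    have *: "x \<in> set_of L" if "x \<in> set_of K" "dist K L = 0" for x and K L :: cbody
    proof -
      have "infdist x (set_of L) = 0"
        using infdist_le_hausdorff_dist[OF that(1), of L] that(2) infdist_nonneg[of x "set_of L"]
        by (simp add: dist_cbody_def)
      then show ?thesis
        using in_closed_iff_infdist_zero[of "set_of L" x] set_of_props compact_imp_closed by blast
    qed
    have "dist L K = 0"
      using 0 by (simp add: dist_cbody_def hausdorff_dist_commute)
    then show "K = L"
      using *[of _ K L] *[of _ L K] 0 by (auto simp flip: set_of_inject)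
  next
    assume "K = L"
    have "hausdorff_dist (set_of L) (set_of L) \<le> 0"
      by (rule hausdorff_dist_least) (auto simp: thicken_infdist set_of_props)
    with \<open>K = L\<close> show "dist K L = 0"
      using hausdorff_dist_nonneg[of L L] by (simp add: dist_cbody_def)
  qed
  have tri: "infdist x (set_of L) \<le> dist K J + dist L J" if "x \<in> set_of K" for x and K L J :: cbody
  proof -
    obtain y where y: "y \<in> set_of J" "infdist x (set_of J) = dist x y"
      using infdist_attains_inf[of "set_of J" x] set_of_props compact_imp_closed by metis
    have "infdist x (set_of L) \<le> infdist y (set_of L) + dist x y"
      by (rule infdist_triangle)
    then show ?thesis
      using infdist_le_hausdorff_dist[OF that, of J] infdist_le_hausdorff_dist[OF y(1), of L] y(2)
      by (simp add: dist_cbody_def hausdorff_dist_commute)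
  qed
  show "dist K L \<le> dist K J + dist L J"
    unfolding dist_cbody_def[of K L]
  proof (rule hausdorff_dist_least)
    show "0 \<le> dist K J + dist L J"
      by (simp add: dist_cbody_def hausdorff_dist_nonneg)
    show "set_of K \<subseteq> thicken (set_of L) (dist K J + dist L J)"
      using tri[of _ K L J] by (auto simp: thicken_infdist set_of_props)
    show "set_of L \<subseteq> thicken (set_of K) (dist K J + dist L J)"
      using tri[of _ L K J] by (auto simp: thicken_infdist set_of_props add.commute)
  qed
qed (simp_all only: uniformity_cbody_def open_cbody_def)

end

section \<open>Convex hulls of a planar random walk\<close>

text \<open>The increments are \<open>Z 1, Z 2, \<dots>\<close>; the value \<open>Z 0\<close> is never used.\<close>

definition walk :: "(nat \<Rightarrow> 'a \<Rightarrow> real^2) \<Rightarrow> nat \<Rightarrow> 'a \<Rightarrow> real^2" where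
  "walk Z n \<omega> = (\<Sum>k=1..n. Z k \<omega>)"

definition walk_hull :: "(nat \<Rightarrow> 'a \<Rightarrow> real^2) \<Rightarrow> nat \<Rightarrow> 'a \<Rightarrow> cbody" where
  "walk_hull Z n \<omega> = Abs_cbody (convex hull ((\<lambda>k. walk Z k \<omega>) ` {0..n}))"

lemma set_of_walk_hull: "set_of (walk_hull Z n \<omega>) = convex hull ((\<lambda>k. walk Z k \<omega>) ` {0..n})"
proof -
  have "0 \<in> (\<lambda>k. walk Z k \<omega>) ` {0..n}"
    by (rule image_eqI[of _ _ 0]) (auto simp: walk_def)
  then have "0 \<in> convex hull ((\<lambda>k. walk Z k \<omega>) ` {0..n})"
    by (rule hull_inc)
  then show ?thesis
    unfolding walk_hull_def
    by (intro Abs_cbody_inverse) (simp add: compact_convex_hull finite_imp_compact)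
qed

definition hull_inradius :: "(nat \<Rightarrow> 'a \<Rightarrow> real^2) \<Rightarrow> nat \<Rightarrow> 'a \<Rightarrow> real" where
  "hull_inradius Z n \<omega> = Inf (norm ` (- set_of (walk_hull Z n \<omega>)))"

text \<open>\<open>prob_space.tail_events\<close> is the intersection over \<open>n\<close> of the
  \<open>\<sigma>\<close>-algebras generated by the families with index at least \<open>n\<close>; here the \<open>m\<close>-th family is the
  \<open>\<sigma>\<close>-algebra generated by the \<open>m\<close>-th hull alone.\<close>

definition hull_tail :: "'a measure \<Rightarrow> (nat \<Rightarrow> 'a \<Rightarrow> real^2) \<Rightarrow> 'a set set" where
  "hull_tail M Z =
     prob_space.tail_events M (\<lambda>m. sets (vimage_algebra (space M) (walk_hull Z m) borel))"

section \<open>Measurability of the hulls\<close>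

lemma hull_subset_thicken:
  assumes le: "\<And>i. i \<in> I \<Longrightarrow> dist (p i) (q i) \<le> \<delta>"
    and I: "finite I" "I \<noteq> {}"
  shows "convex hull (p ` I) \<subseteq> thicken (convex hull (q ` I)) \<delta>"
proof -
  let ?C = "convex hull (q ` I)"
  let ?D = "\<Union>y\<in>?C. \<Union>b\<in>cball 0 \<delta>. {y + b}"
  have "convex hull (p ` I) \<subseteq> ?D"
  proof (rule hull_minimal)
    show "convex ?D"
      by (rule convex_sums) auto
    show "p ` I \<subseteq> ?D"
    proof
      fix x assume "x \<in> p ` I"
      then obtain i where i: "i \<in> I" "x = p i" by blast
      have "q i \<in> ?C" "p i - q i \<in> cball 0 \<delta>" "x = q i + (p i - q i)"
        using i le[OF i(1)] by (auto intro: hull_inc simp: dist_norm norm_minus_commute)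
      then show "x \<in> ?D" by blast
    qed
  qed
  also have "?D \<subseteq> thicken ?C \<delta>"
  proof -
    have "infdist (y + b) ?C \<le> \<delta>" if "y \<in> ?C" "b \<in> cball 0 \<delta>" for y b
      using infdist_le[OF that(1), of "y + b"] that(2) by (simp add: dist_norm)
    moreover have "?C \<noteq> {}" using I by simp
    ultimately show ?thesis by (auto simp: thicken_infdist)
  qed
  finally show ?thesis .
qed

lemma continuous_walk_hull:
  "continuous_on UNIV (\<lambda>s. walk_hull (\<lambda>i s. s i) n (s :: nat \<Rightarrow> real^2))"
proof -
  let ?H = "\<lambda>s :: nat \<Rightarrow> real^2. walk_hull (\<lambda>i s. s i) n s"
  let ?w = "\<lambda>k (s :: nat \<Rightarrow> real^2). walk (\<lambda>i s. s i) k s"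
  have w: "isCont (?w k) s" for k s
  proof -
    have "continuous_on UNIV (?w k)"
      unfolding walk_def by (intro continuous_on_sum continuous_on_product_coordinates)
    then show ?thesis by (simp add: continuous_on_eq_continuous_at)
  qed
  have le: "dist (?H t) (?H s) \<le> (\<Sum>k=0..n. dist (?w k t) (?w k s))" (is "_ \<le> ?d s t") for s t
  proof -
    have k: "dist (?w k t) (?w k s) \<le> ?d s t" if "k \<in> {0..n}" for k
      using that by (intro member_le_sum) auto
    have k': "dist (?w k s) (?w k t) \<le> ?d s t" if "k \<in> {0..n}" for k
      using k[OF that] by (simp add: dist_commute)
    show ?thesis
      unfolding dist_cbody_def
    proof (rule hausdorff_dist_least)
      show "0 \<le> ?d s t"
        by (simp add: sum_nonneg)
      show "set_of (?H t) \<subseteq> thicken (set_of (?H s)) (?d s t)"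
        unfolding set_of_walk_hull by (rule hull_subset_thicken) (use k in auto)
      show "set_of (?H s) \<subseteq> thicken (set_of (?H t)) (?d s t)"
        unfolding set_of_walk_hull by (rule hull_subset_thicken) (use k' in auto)
    qed
  qed
  have "isCont ?H s" for s
  proof -
    have "((\<lambda>t. dist (?w k t) (?w k s)) \<longlongrightarrow> 0) (at s)" for k
      using tendsto_dist[OF isContD[OF w[where k = k and s = s]] tendsto_const[of "?w k s"]] by simp
    then have "((\<lambda>t. ?d s t) \<longlongrightarrow> (\<Sum>k=0..n. 0)) (at s)"
      by (intro tendsto_sum)
    then have "((\<lambda>t. ?d s t) \<longlongrightarrow> 0) (at s)" by simp
    then have "((\<lambda>t. dist (?H t) (?H s)) \<longlongrightarrow> 0) (at s)"
      by (rule tendsto_sandwich[OF _ _ tendsto_const, rotated 2]) (auto simp: le)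
    then show ?thesis
      unfolding isCont_def by (subst tendsto_dist_iff)
  qed
  then show ?thesis by (simp add: continuous_on_eq_continuous_at)
qed

lemma borel_measurable_walk_hull:
  assumes Z: "\<And>k. k \<ge> 1 \<Longrightarrow> Z k \<in> borel_measurable M"
  shows "walk_hull Z n \<in> borel_measurable M"
proof -
  let ?s = "\<lambda>\<omega> i. if i = 0 then 0 else Z i \<omega>"
  have "?s \<in> borel_measurable M"
  proof (rule measurable_coordinatewise_then_product)
    show "(\<lambda>\<omega>. ?s \<omega> i) \<in> borel_measurable M" for i
      using Z[of i] by (cases "i = 0") auto
  qed
  then have "(\<lambda>\<omega>. walk_hull (\<lambda>i s. s i) n (?s \<omega>)) \<in> borel_measurable M"
    by (rule measurable_compose[OF _ borel_measurable_continuous_onI[OF continuous_walk_hull]])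
  moreover have "walk_hull (\<lambda>i s. s i) n (?s \<omega>) = walk_hull Z n \<omega>" for \<omega>
    by (simp add: walk_hull_def walk_def)
  ultimately show ?thesis by simp
qed

lemma hull_tail_subset_sets:
  assumes "prob_space M" and Z: "\<And>k. k \<ge> 1 \<Longrightarrow> Z k \<in> borel_measurable M"
  shows "hull_tail M Z \<subseteq> sets M"
proof -
  interpret prob_space M by fact
  show ?thesis
    unfolding hull_tail_def
    by (intro tail_events_sets)
       (use measurable_sets[OF borel_measurable_walk_hull[OF Z]] in \<open>auto simp: sets_vimage_algebra2\<close>)
qed

end

theory Submission
  imports Defs
begin

text \<open>
  Why hull tail events are trivial. If the first \<open>k\<close> increments of the walk are permuted, the walk is
  unchanged from time \<open>k\<close> on. The finitely many earlier positions, of the original and of the permuted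
  walk, lie in some ball about the origin, and once the hull contains that ball in its interior none of
  them is an extreme point; so from some random time on both walks have the same hull
  (\<open>eventually_walk_hull_eq\<close>). A tail event is, for every \<open>m\<close>, determined by the hulls of index at
  least \<open>m\<close>, so it is almost surely invariant under every finite permutation of the increments, and the
  Hewitt--Savage zero-one law applies to it.

  Two points need care. First, the time from which the hulls agree is random, while each description of
  the event uses a fixed \<open>m\<close>. The event is therefore represented, for every \<open>m\<close>, by a measurable set
  \<open>C m\<close> of sequences that sees only the hulls of index at least \<open>m\<close> (\<open>hull_tail_factorization\<close>). All
  the \<open>C m\<close> agree up to null sets of the product law, before and after a permutation since that law is
  permutation invariant, so that \<open>m\<close> may be chosen depending on the outcome.

  Secondly, the event is permutation invariant only up to null sets, so the zero-one law is proved for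
  such sets (\<open>hewitt_savage_zero_one\<close>). Exchanging the first \<open>n\<close> coordinates with the next \<open>n\<close> makes any
  event asymptotically independent of a fixed cylinder: this is clear for cylinders and extends to all
  events by a mixing criterion of Renyi (\<open>mixing_on_generator\<close>). An almost invariant \<open>C\<close> is thus exactly
  independent of every cylinder, hence of itself.
\<close>

section \<open>Convex hulls that contain a large ball\<close>

text \<open>
  A compact convex set is the hull of its extreme points, and no extreme point lies in the open ball,
  because the ball is contained in the interior of the hull. So only the points outside the ball matter.
\<close>

lemma convex_hull_eq_if_agree_outside_ball:
  fixes S T :: "'a::euclidean_space set"
  assumes "compact S" and ball: "ball x r \<subseteq> convex hull S"
    and agree: "S - ball x r = T - ball x r"
  shows "convex hull T = convex hull S"
proof
  have "T \<subseteq> S \<union> ball x r"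
    using agree by blast
  then have "T \<subseteq> convex hull S"
    using ball hull_subset[of S convex] by blast
  then show "convex hull T \<subseteq> convex hull S"
    by (simp add: hull_minimal)
next
  have "{y. y extreme_point_of convex hull S} \<subseteq> T"
  proof
    fix y assume "y \<in> {y. y extreme_point_of convex hull S}"
    then have y: "y extreme_point_of convex hull S"
      by simp
    then have "y \<in> S"
      by (rule extreme_point_of_convex_hull)
    moreover have "y \<notin> ball x r"
      using extreme_point_not_in_interior[OF y] interior_maximal[OF ball] by auto
    ultimately show "y \<in> T"
      using agree by blast
  qed
  moreover have "convex hull S = convex hull {y. y extreme_point_of convex hull S}"
    using \<open>compact S\<close> by (intro Krein_Milman_Minkowski) (simp_all add: compact_convex_hull)
  ultimately show "convex hull S \<subseteq> convex hull T"
    by (metis hull_mono)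
qed

lemma ball_hull_inradius_subset:
  "ball 0 (hull_inradius Z n \<omega>) \<subseteq> set_of (walk_hull Z n \<omega>)"
proof
  fix x :: "real^2" assume x: "x \<in> ball 0 (hull_inradius Z n \<omega>)"
  show "x \<in> set_of (walk_hull Z n \<omega>)"
  proof (rule ccontr)
    assume "x \<notin> set_of (walk_hull Z n \<omega>)"
    then have "hull_inradius Z n \<omega> \<le> norm x"
      unfolding hull_inradius_def by (intro cInf_lower bdd_belowI[of _ 0]) auto
    then show False
      using x by simp
  qed
qed

text \<open>
  Beginning with the time when the inradius exceeds the norms of all positions up to time \<open>k\<close>, the
  positions at which the two walks differ are absorbed by the ball. The inradius of only one of the two
  walks enters, so that an assumption on the original walk suffices when its increments are permuted.
\<close>

lemma eventually_walk_hull_eq: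
  assumes walk: "\<And>j. j \<ge> k \<Longrightarrow> walk Z j \<omega> = walk Y j \<nu>"
    and inradius: "filterlim (\<lambda>n. hull_inradius Z n \<omega>) at_top sequentially"
  shows "\<forall>\<^sub>F n in sequentially. walk_hull Y n \<nu> = walk_hull Z n \<omega>"
proof -
  define r where "r = Max (norm ` ((\<lambda>j. walk Z j \<omega>) ` {..k} \<union> (\<lambda>j. walk Y j \<nu>) ` {..k}))"
  have r: "norm (walk Z j \<omega>) \<le> r" "norm (walk Y j \<nu>) \<le> r" if "j \<le> k" for j
    unfolding r_def using that by (auto intro!: Max_ge)
  have "\<forall>\<^sub>F n in sequentially. r < hull_inradius Z n \<omega>"
    using inradius unfolding filterlim_at_top_dense by blast
  then show ?thesis
  proof eventually_elim
    case (elim n)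
    let ?B = "ball 0 (hull_inradius Z n \<omega>) :: (real^2) set"
    have early: "walk Z j \<omega> \<in> ?B \<and> walk Y j \<nu> \<in> ?B" if "\<not> j \<ge> k" for j
      using r[of j] elim that by auto
    have "(\<lambda>j. walk Z j \<omega>) ` {0..n} - ?B = (\<lambda>j. walk Y j \<nu>) ` {0..n} - ?B"
    proof (intro set_eqI iffI)
      fix x assume "x \<in> (\<lambda>j. walk Z j \<omega>) ` {0..n} - ?B"
      then obtain j where j: "j \<in> {0..n}" "x = walk Z j \<omega>" "x \<notin> ?B" by blast
      then have "x = walk Y j \<nu>"
        using early[of j] walk[of j] by blast
      then show "x \<in> (\<lambda>j. walk Y j \<nu>) ` {0..n} - ?B"
        using j by blast
    next
      fix x assume "x \<in> (\<lambda>j. walk Y j \<nu>) ` {0..n} - ?B"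
      then obtain j where j: "j \<in> {0..n}" "x = walk Y j \<nu>" "x \<notin> ?B" by blast
      then have "x = walk Z j \<omega>"
        using early[of j] walk[of j] by metis
      then show "x \<in> (\<lambda>j. walk Z j \<omega>) ` {0..n} - ?B"
        using j by blast
    qed
    moreover have "?B \<subseteq> convex hull ((\<lambda>j. walk Z j \<omega>) ` {0..n})"
      using ball_hull_inradius_subset[of Z n \<omega>] by (simp add: set_of_walk_hull)
    ultimately have "convex hull ((\<lambda>j. walk Y j \<nu>) ` {0..n}) = convex hull ((\<lambda>j. walk Z j \<omega>) ` {0..n})"
      by (intro convex_hull_eq_if_agree_outside_ball[where x = 0 and r = "hull_inradius Z n \<omega>"])
         (auto intro: finite_imp_compact)
    then show ?case
      by (simp add: walk_hull_def)
  qed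
qed

section \<open>The Hewitt--Savage zero-one law\<close>

text \<open>
  Renyi's criterion: for a fixed sequence \<open>F\<close> and a fixed limit \<open>c\<close>, the sets \<open>D\<close> with
  \<open>prob (D \<inter> F n) \<longlonglongrightarrow> prob D * c\<close> form a Dynkin system. For a disjoint union the limit and the
  sum may be exchanged by Tannery's theorem, since \<open>prob (A k \<inter> F n)\<close> is at most \<open>prob (A k)\<close>,
  which is summable. With \<open>F\<close> constant, this is the usual extension of independence from a generator.
\<close>

lemma (in prob_space) mixing_on_generator:
  fixes F :: "nat \<Rightarrow> 'a set"
  assumes G: "Int_stable G" "space M \<in> G" "events = sigma_sets (space M) G"
    and F: "\<And>n. F n \<in> events"
    and lim: "\<And>D. D \<in> G \<Longrightarrow> (\<lambda>n. prob (D \<inter> F n)) \<longlonglongrightarrow> prob D * c"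
    and D: "D \<in> events"
  shows "(\<lambda>n. prob (D \<inter> F n)) \<longlonglongrightarrow> prob D * c"
proof -
  have GP: "G \<subseteq> Pow (space M)"
    using G(3) sets.sets_into_space by blast
  show ?thesis
    using G(1) GP D[unfolded G(3)]
  proof (induction rule: sigma_sets_induct_disjoint)
    case (basic D)
    then show ?case by (rule lim)
  next
    case empty
    then show ?case by simp
  next
    case (compl D)
    then have D: "D \<in> events"
      by (simp add: G(3))
    have "prob ((space M - D) \<inter> F n) = prob (space M \<inter> F n) - prob (D \<inter> F n)" for n
    proof -
      have "(space M - D) \<inter> F n = space M \<inter> F n - D \<inter> F n"
        by auto
      then show ?thesis
        using D F[of n] sets.sets_into_space[OF D] by (auto intro!: finite_measure_Diff)
    qed
    moreover have "prob (space M - D) * c = prob (space M) * c - prob D * c"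
      unfolding prob_compl[OF D] by (simp add: prob_space algebra_simps)
    ultimately show ?case
      using tendsto_diff[OF lim[OF G(2)] compl(2)] by simp
  next
    case (union A)
    then have A: "range A \<subseteq> events"
      by (simp add: G(3))
    have AF: "(\<lambda>k. prob (A k \<inter> F n)) sums prob ((\<Union>k. A k) \<inter> F n)" for n
    proof -
      have "(\<lambda>k. prob (A k \<inter> F n)) sums prob (\<Union>k. A k \<inter> F n)"
        using A F[of n] union(1)
        by (intro finite_measure_UNION) (auto simp: disjoint_family_on_def)
      then show ?thesis
        by (simp add: Int_UN_distrib2)
    qed
    have sumA: "(\<lambda>k. prob (A k)) sums prob (\<Union>k. A k)"
      using A union(1) by (rule finite_measure_UNION)
    have "(\<lambda>n. \<Sum>k. prob (A k \<inter> F n)) \<longlonglongrightarrow> (\<Sum>k. prob (A k) * c)"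
    proof (rule tannerys_theorem[THEN conjunct2, THEN conjunct2])
      show "\<forall>\<^sub>F (k, n) in at_top \<times>\<^sub>F sequentially. norm (prob (A k \<inter> F n)) \<le> prob (A k)"
        using A by (intro always_eventually) (auto intro!: finite_measure_mono)
      show "summable (\<lambda>k. prob (A k))"
        using sumA by (rule sums_summable)
    qed (use union in auto)
    then show ?case
      using sums_unique[OF AF] sums_unique[OF sums_mult2[OF sumA, of c]] by simp
  qed
qed

definition swap_blocks :: "nat \<Rightarrow> nat \<Rightarrow> nat" where
  "swap_blocks n i = (if i < n then i + n else if i < 2 * n then i - n else i)"

lemma swap_blocks_permutes: "swap_blocks n permutes {..<2 * n}"
proof (rule bij_imp_permutes)
  have "swap_blocks n \<circ> swap_blocks n = id"
    by (auto simp: swap_blocks_def fun_eq_iff)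
  then have "swap_blocks n (swap_blocks n i) = i" for i
    by (simp add: fun_eq_iff)
  then show "bij_betw (swap_blocks n) {..<2 * n} {..<2 * n}"
    by (intro bij_betw_byWitness[where f' = "swap_blocks n"]) (auto simp: swap_blocks_def)
qed (auto simp: swap_blocks_def)

context sequence_space
begin

lemma distr_permute:
  assumes "inj \<pi>"
  shows "distr S S (\<lambda>s. s \<circ> \<pi>) = S"
  using distr_PiM_reindex[of UNIV "\<lambda>_. M" \<pi> UNIV] assms
  by (simp add: M.prob_space_axioms comp_def restrict_UNIV)

lemma measurable_permute: "(\<lambda>s. s \<circ> \<pi>) \<in> measurable S S"
  unfolding comp_def by (intro measurable_PiM_single') (auto simp: space_PiM PiE_iff)

lemma prob_permute_vimage:
  assumes "inj \<pi>" "D \<in> sets S"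
  shows "measure S ((\<lambda>s. s \<circ> \<pi>) -` D \<inter> space S) = measure S D"
  using measure_distr[OF measurable_permute[of \<pi>] assms(2)] distr_permute[OF assms(1)] by simp

definition cylinders :: "(nat \<Rightarrow> 'a) set set" where
  "cylinders = {\<Pi>\<^sub>E i\<in>UNIV. X i | X. (\<forall>i. X i \<in> sets M) \<and> finite {i. X i \<noteq> space M}}"

lemma sets_eq_sigma_cylinders: "sets S = sigma_sets (space S) cylinders"
  unfolding cylinders_def space_PiM by (rule sets_PiM_finite)

lemma space_in_cylinders: "space S \<in> cylinders"
  unfolding cylinders_def space_PiM by (auto intro!: exI[of _ "\<lambda>_. space M"])

lemma Int_stable_cylinders: "Int_stable cylinders"
proof (rule Int_stableI)
  fix D E assume "D \<in> cylinders" "E \<in> cylinders"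
  then obtain X Y where
    X: "D = (\<Pi>\<^sub>E i\<in>UNIV. X i)" "\<And>i. X i \<in> sets M" "finite {i. X i \<noteq> space M}" and
    Y: "E = (\<Pi>\<^sub>E i\<in>UNIV. Y i)" "\<And>i. Y i \<in> sets M" "finite {i. Y i \<noteq> space M}"
    unfolding cylinders_def by blast
  have "finite {i. X i \<inter> Y i \<noteq> space M}"
    by (rule finite_subset[OF _ finite_UnI[OF X(3) Y(3)]]) auto
  then show "D \<inter> E \<in> cylinders"
    unfolding cylinders_def using X Y by (auto simp: PiE_Int intro!: exI[of _ "\<lambda>i. X i \<inter> Y i"])
qed

lemma cylinder_bounded:
  assumes "D \<in> cylinders"
  obtains X n where "D = (\<Pi>\<^sub>E i\<in>UNIV. X i)" "\<And>i. X i \<in> sets M" "\<And>i. i \<ge> n \<Longrightarrow> X i = space M"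
proof -
  obtain X where X: "D = (\<Pi>\<^sub>E i\<in>UNIV. X i)" "\<And>i. X i \<in> sets M" "finite {i. X i \<noteq> space M}"
    using assms unfolding cylinders_def by blast
  obtain n where "{i. X i \<noteq> space M} \<subseteq> {..<n}"
    using finite_nat_iff_bounded[THEN iffD1, OF X(3)] by blast
  then have "X i = space M" if "i \<ge> n" for i
    using that by (metis (mono_tags) lessThan_iff mem_Collect_eq not_le subsetD)
  with X(1,2) show ?thesis
    by (rule that)
qed

lemma prob_cylinder:
  assumes X: "\<And>i. X i \<in> sets M" and n: "\<And>i. i \<ge> n \<Longrightarrow> X i = space M"
  shows "measure S (\<Pi>\<^sub>E i\<in>UNIV. X i) = (\<Prod>i<n. measure M (X i))"
proof -
  have "s i \<in> X i" if "s \<in> space S" "\<forall>i<n. s i \<in> X i" for s i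
    using n[of i] that by (cases "i < n") (auto simp: space_PiM)
  moreover have "(\<Pi>\<^sub>E i\<in>UNIV. X i) \<subseteq> space S"
    using sets.sets_into_space[OF X] unfolding space_PiM by (intro PiE_mono)
  ultimately have "(\<Pi>\<^sub>E i\<in>UNIV. X i) = {s \<in> space S. \<forall>i<n. s i \<in> X i}"
    unfolding PiE_UNIV_domain by blast
  also have "\<dots> = emb UNIV {..<n} (\<Pi>\<^sub>E i\<in>{..<n}. X i)"
    by (auto simp: prod_emb_def space_PiM PiE_iff)
  finally have "(\<Pi>\<^sub>E i\<in>UNIV. X i) = emb UNIV {..<n} (\<Pi>\<^sub>E i\<in>{..<n}. X i)" .
  then show ?thesis
    using measure_PiM_emb[of "{..<n}" X] X by simp
qed

text \<open>
  The exchange moves the constraints of \<open>E\<close> from the first block of coordinates to the second one,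
  where \<open>D\<close> imposes none; the intersection is again a cylinder, and its measure factorizes.
\<close>

lemma prob_cylinder_Int_swapped_cylinder:
  assumes X: "\<And>i. X i \<in> sets M" "\<And>i. i \<ge> n \<Longrightarrow> X i = space M"
    and Y: "\<And>i. Y i \<in> sets M" "\<And>i. i \<ge> n \<Longrightarrow> Y i = space M"
  defines "D \<equiv> \<Pi>\<^sub>E i\<in>UNIV. X i" and "E \<equiv> \<Pi>\<^sub>E i\<in>UNIV. Y i"
  shows "measure S (D \<inter> ((\<lambda>s. s \<circ> swap_blocks n) -` E \<inter> space S)) = measure S D * measure S E"
proof -
  define W where "W i = (if i < n then X i else if i < 2 * n then Y (i - n) else space M)" for i
  have W: "W i \<in> sets M" for i
    using X(1) Y(1) by (simp add: W_def)
  have "D \<inter> ((\<lambda>s. s \<circ> swap_blocks n) -` E \<inter> space S) = (\<Pi>\<^sub>E i\<in>UNIV. W i)"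
  proof (intro set_eqI iffI)
    fix s assume s: "s \<in> D \<inter> ((\<lambda>s. s \<circ> swap_blocks n) -` E \<inter> space S)"
    then have 1: "s i \<in> X i" "s (swap_blocks n i) \<in> Y i" "s i \<in> space M" for i
      by (auto simp: D_def E_def PiE_iff space_PiM)
    have "s i \<in> W i" for i
      using 1[of i] 1(2)[of "i - n"]
      by (cases "i < n"; cases "i < 2 * n") (auto simp: W_def swap_blocks_def split: if_splits)
    then show "s \<in> (\<Pi>\<^sub>E i\<in>UNIV. W i)"
      by auto
  next
    fix s assume "s \<in> (\<Pi>\<^sub>E i\<in>UNIV. W i)"
    then have 1: "s i \<in> W i" for i
      by auto
    then have 2: "s i \<in> space M" for i
      using sets.sets_into_space[OF W] by blast
    have "s i \<in> X i" for i
      using 1[of i] 2[of i] X(2)[of i] by (cases "i < n") (auto simp: W_def)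
    moreover have "s (swap_blocks n i) \<in> Y i" for i
      using 1[of "i + n"] 2 Y(2)[of i] by (cases "i < n") (auto simp: W_def swap_blocks_def)
    ultimately show "s \<in> D \<inter> ((\<lambda>s. s \<circ> swap_blocks n) -` E \<inter> space S)"
      using 2 by (auto simp: D_def E_def PiE_iff space_PiM)
  qed
  then have "measure S (D \<inter> ((\<lambda>s. s \<circ> swap_blocks n) -` E \<inter> space S)) = (\<Prod>i<2 * n. measure M (W i))"
    using prob_cylinder[of W "2 * n"] W by (simp add: W_def)
  also have "\<dots> = (\<Prod>i<n. measure M (X i)) * (\<Prod>i<n. measure M (Y i))"
  proof -
    have "(\<Prod>i<2 * n. measure M (W i)) = (\<Prod>i<n. measure M (W i)) * (\<Prod>i\<in>{n..<n + n}. measure M (W i))"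
      by (simp add: mult_2 lessThan_atLeast0 prod.atLeastLessThan_concat)
    also have "(\<Prod>i\<in>{n..<n + n}. measure M (W i)) = (\<Prod>i<n. measure M (W (i + n)))"
      using prod.shift_bounds_nat_ivl[of "\<lambda>i. measure M (W i)" 0 n n] by (simp add: lessThan_atLeast0)
    also have "(\<Prod>i<n. measure M (W i)) = (\<Prod>i<n. measure M (X i))"
      by (intro prod.cong refl) (simp add: W_def)
    also have "(\<Prod>i<n. measure M (W (i + n))) = (\<Prod>i<n. measure M (Y i))"
      by (intro prod.cong refl) (simp add: W_def)
    finally show ?thesis .
  qed
  also have "\<dots> = measure S D * measure S E"
    unfolding D_def E_def using prob_cylinder[of X n, OF X] prob_cylinder[of Y n, OF Y] by metis
  finally show ?thesis .
qed

text \<open>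
  Invariance is assumed only almost surely, and separately for each permutation: for a hull tail event,
  the exceptional null set depends on the permutation.
\<close>

theorem hewitt_savage_zero_one:
  assumes C: "C \<in> sets S"
    and inv: "\<And>n \<pi>. \<pi> permutes {..<n} \<Longrightarrow> AE s in S. s \<in> C \<longleftrightarrow> s \<circ> \<pi> \<in> C"
  shows "measure S C \<in> {0, 1}"
proof -
  let ?\<sigma> = "\<lambda>n D. (\<lambda>s. s \<circ> swap_blocks n) -` D \<inter> space S"
  have \<sigma>_sets: "?\<sigma> n D \<in> sets S" if "D \<in> sets S" for n D
    using measurable_permute that by (rule measurable_sets)
  have cyl_sets: "E \<in> sets S" if "E \<in> cylinders" for E
    using that unfolding sets_eq_sigma_cylinders by blast
  have indep: "measure S (E \<inter> C) = measure S E * measure S C" if E: "E \<in> cylinders" for E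
  proof -
    have "(\<lambda>n. measure S (C \<inter> ?\<sigma> n E)) \<longlonglongrightarrow> measure S C * measure S E"
    proof (rule P.mixing_on_generator[OF Int_stable_cylinders space_in_cylinders
             sets_eq_sigma_cylinders _ _ C])
      show "?\<sigma> n E \<in> sets S" for n
        by (intro \<sigma>_sets cyl_sets E)
      fix D assume D: "D \<in> cylinders"
      obtain X k where X: "D = (\<Pi>\<^sub>E i\<in>UNIV. X i)" "\<And>i. X i \<in> sets M" "\<And>i. i \<ge> k \<Longrightarrow> X i = space M"
        using D by (rule cylinder_bounded) blast
      obtain Y l where Y: "E = (\<Pi>\<^sub>E i\<in>UNIV. Y i)" "\<And>i. Y i \<in> sets M" "\<And>i. i \<ge> l \<Longrightarrow> Y i = space M"
        using E by (rule cylinder_bounded) blast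
      have "measure S (D \<inter> ?\<sigma> n E) = measure S D * measure S E" if "n \<ge> max k l" for n
        unfolding X(1) Y(1) using X Y that by (intro prob_cylinder_Int_swapped_cylinder) auto
      then show "(\<lambda>n. measure S (D \<inter> ?\<sigma> n E)) \<longlonglongrightarrow> measure S D * measure S E"
        by (intro tendsto_eventually eventually_sequentiallyI)
    qed
    \<comment> \<open>The sequence is constant: \<open>C\<close> may be replaced by its own preimage under the exchange, and the
      exchange preserves the product measure.\<close>
    moreover have "measure S (C \<inter> ?\<sigma> n E) = measure S (C \<inter> E)" for n
    proof -
      have "AE s in S. s \<in> C \<inter> ?\<sigma> n E \<longleftrightarrow> s \<in> ?\<sigma> n (C \<inter> E)"
        using inv[OF swap_blocks_permutes[of n]] by eventually_elim auto
      then have "measure S (C \<inter> ?\<sigma> n E) = measure S (?\<sigma> n (C \<inter> E))"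
        by (rule measure_eq_AE) (intro sets.Int \<sigma>_sets C cyl_sets E)+
      also have "\<dots> = measure S (C \<inter> E)"
        using C cyl_sets[OF E] permutes_inj[OF swap_blocks_permutes]
        by (intro prob_permute_vimage) auto
      finally show ?thesis .
    qed
    ultimately show ?thesis
      by (simp add: LIMSEQ_const_iff Int_commute mult.commute)
  qed
  \<comment> \<open>Independence of \<open>C\<close> from all cylinders extends to all events, in particular to \<open>C\<close> itself.\<close>
  have "(\<lambda>n::nat. measure S (C \<inter> C)) \<longlonglongrightarrow> measure S C * measure S C"
    by (rule P.mixing_on_generator[OF Int_stable_cylinders space_in_cylinders
          sets_eq_sigma_cylinders C _ C])
       (simp add: indep)
  then have "measure S C = measure S C * measure S C"
    by (simp only: LIMSEQ_const_iff Int_absorb)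
  then show ?thesis
    by (simp only: mult_cancel_right1) auto
qed

end

section \<open>Tail events of the hulls\<close>

text \<open>
  On sequence space the increments are numbered from \<open>0\<close>, as coordinates of the product over all
  natural numbers, whereas the walk adds up its increments from index \<open>1\<close>; hence the shift.
\<close>

definition seq_hull :: "nat \<Rightarrow> (nat \<Rightarrow> real^2) \<Rightarrow> cbody" where
  "seq_hull n s = walk_hull (\<lambda>k s. s (k - 1)) n s"

lemma walk_hull_eq_seq_hull: "walk_hull Z n \<omega> = seq_hull n (\<lambda>i. Z (Suc i) \<omega>)"
  by (simp add: seq_hull_def walk_hull_def walk_def)

lemma measurable_seq_hull: "seq_hull n \<in> borel_measurable (\<Pi>\<^sub>M i\<in>UNIV. borel)"
  unfolding seq_hull_def[abs_def] by (rule borel_measurable_walk_hull) simp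

lemma eventually_seq_hull_permute:
  assumes \<pi>: "\<pi> permutes {..<k}"
    and inradius: "filterlim (\<lambda>n. hull_inradius Z n \<omega>) at_top sequentially"
  defines "s \<equiv> \<lambda>i. Z (Suc i) \<omega>"
  shows "\<forall>\<^sub>F n in sequentially. seq_hull n (s \<circ> \<pi>) = seq_hull n s"
proof -
  have "walk Z j \<omega> = walk (\<lambda>k s. s (k - 1)) j (s \<circ> \<pi>)" if "j \<ge> k" for j
  proof -
    have "\<pi> permutes {..<j}"
      using that by (intro permutes_subset[OF \<pi>]) auto
    have walk_s: "walk (\<lambda>k s. s (k - 1)) j t = (\<Sum>i<j. t i)" for t :: "nat \<Rightarrow> real^2"
      unfolding walk_def by (rule sum.reindex_bij_witness[of _ Suc "\<lambda>i. i - 1"]) auto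
    have "walk Z j \<omega> = (\<Sum>i<j. s i)"
      unfolding walk_s[symmetric] by (simp add: walk_def s_def)
    also have "\<dots> = (\<Sum>i<j. s (\<pi> i))"
      using \<open>\<pi> permutes {..<j}\<close> by (rule sum.permute[unfolded comp_def])
    finally show ?thesis
      by (simp only: walk_s comp_def)
  qed
  then have "\<forall>\<^sub>F n in sequentially. walk_hull (\<lambda>k s. s (k - 1)) n (s \<circ> \<pi>) = walk_hull Z n \<omega>"
    using inradius by (rule eventually_walk_hull_eq)
  then show ?thesis
    unfolding walk_hull_eq_seq_hull[of Z] s_def seq_hull_def[symmetric] .
qed

text \<open>
  The preimages of such sets \<open>C\<close> form a \<open>\<sigma>\<close>-algebra that contains the events generated by each
  single hull of index at least \<open>m\<close>. Here \<open>C\<close> depends on \<open>m\<close>; different choices agree on the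
  range of the increment sequence but need not agree on all sequences.
\<close>

lemma hull_tail_factorization:
  assumes "prob_space M" and A: "A \<in> hull_tail M Z"
  shows "\<exists>C. C \<in> sets (\<Pi>\<^sub>M i\<in>UNIV. borel) \<and> A = {\<omega> \<in> space M. (\<lambda>i. Z (Suc i) \<omega>) \<in> C} \<and>
    (\<forall>s t. (\<forall>n\<ge>m. seq_hull n s = seq_hull n t) \<longrightarrow> s \<in> C \<longleftrightarrow> t \<in> C)"
proof -
  interpret prob_space M by fact
  let ?P = "\<lambda>A C. C \<in> sets (\<Pi>\<^sub>M i\<in>UNIV. borel) \<and> A = {\<omega> \<in> space M. (\<lambda>i. Z (Suc i) \<omega>) \<in> C} \<and>
    (\<forall>s t. (\<forall>n\<ge>m. seq_hull n s = seq_hull n t) \<longrightarrow> s \<in> C \<longleftrightarrow> t \<in> C)"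
  have "A \<in> sigma_sets (space M) (\<Union>i\<in>{m..}. sets (vimage_algebra (space M) (walk_hull Z i) borel))"
    using A unfolding hull_tail_def tail_events_def by blast
  then show ?thesis
  proof induction
    case (Basic A)
    then obtain n B where nB: "n \<ge> m" "B \<in> sets borel" "A = walk_hull Z n -` B \<inter> space M"
      by (auto simp: sets_vimage_algebra2)
    have "seq_hull n -` B \<inter> space (\<Pi>\<^sub>M i\<in>UNIV. borel) \<in> sets (\<Pi>\<^sub>M i\<in>UNIV. borel)"
      using measurable_seq_hull nB(2) by (rule measurable_sets)
    then have "?P A (seq_hull n -` B)"
      using nB by (auto simp: space_PiM walk_hull_eq_seq_hull)
    then show ?case ..
  next
    case Empty
    show ?case by (intro exI[of _ "{}"]) auto
  next
    case (Compl A)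
    then obtain C where C: "?P A C" by blast
    have "space (\<Pi>\<^sub>M i\<in>UNIV. borel) - C \<in> sets (\<Pi>\<^sub>M i\<in>(UNIV::nat set). (borel :: (real^2) measure))"
      using C by blast
    then have "?P (space M - A) (- C)"
      using C by (auto simp: space_PiM Compl_eq_Diff_UNIV)
    then show ?case ..
  next
    case (Union A)
    then have "\<forall>i. \<exists>C. ?P (A i) C" by blast
    then have "\<exists>C. \<forall>i. ?P (A i) (C i)" by (rule choice)
    then obtain C where C: "\<forall>i. ?P (A i) (C i)" ..
    have "?P (\<Union>i. A i) (\<Union>i. C i)"
    proof (intro conjI allI impI)
      show "(\<Union>i. C i) \<in> sets (\<Pi>\<^sub>M i\<in>UNIV. borel)"
        using C by (intro sets.countable_UN) auto
      show "(\<Union>i. A i) = {\<omega> \<in> space M. (\<lambda>i. Z (Suc i) \<omega>) \<in> (\<Union>i. C i)}"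
        using C by auto
      show "s \<in> (\<Union>i. C i) \<longleftrightarrow> t \<in> (\<Union>i. C i)" if "\<forall>n\<ge>m. seq_hull n s = seq_hull n t" for s t
        using C that by (simp only: UN_iff)
    qed
    then show ?case ..
  qed
qed

lemma (in prob_space) distr_iid_subsequence:
  assumes indep: "indep_vars (\<lambda>_. N) Z I"
    and ident: "\<And>k. k \<in> I \<Longrightarrow> distr M N (Z k) = \<mu>"
    and f: "inj f" "range f \<subseteq> I"
  shows "distr M (\<Pi>\<^sub>M i\<in>UNIV. N) (\<lambda>\<omega> i. Z (f i) \<omega>) = (\<Pi>\<^sub>M i\<in>UNIV. \<mu>)"
proof -
  have rv: "Z k \<in> measurable M N" if "k \<in> I" for k
    using indep that by (simp add: indep_vars_def2)
  have I: "I \<noteq> {}"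
    using f(2) by auto
  then obtain k where k: "k \<in> I" by blast
  have sets_\<mu>: "sets \<mu> = sets N"
    unfolding ident[OF k, symmetric] by simp
  have prob_\<mu>: "prob_space \<mu>"
    unfolding ident[OF k, symmetric] by (rule prob_space_distr[OF rv[OF k]])
  let ?R = "\<lambda>\<omega>. \<lambda>k\<in>I. Z k \<omega>" and ?F = "\<lambda>z i. z (f i)"
  have law: "distr M (\<Pi>\<^sub>M k\<in>I. N) ?R = (\<Pi>\<^sub>M k\<in>I. \<mu>)"
    using indep indep_vars_iff_distr_eq_PiM'[OF I rv] ident by (simp cong: PiM_cong)
  have F: "?F \<in> measurable (\<Pi>\<^sub>M k\<in>I. N) (\<Pi>\<^sub>M i\<in>UNIV. N)"
    using f(2) by (intro measurable_PiM_single' measurable_component_singleton)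
      (auto simp: space_PiM PiE_iff)
  have R: "?R \<in> measurable M (\<Pi>\<^sub>M k\<in>I. N)"
    using rv by (intro measurable_restrict)
  have "distr M (\<Pi>\<^sub>M i\<in>UNIV. N) (\<lambda>\<omega> i. Z (f i) \<omega>) = distr M (\<Pi>\<^sub>M i\<in>UNIV. N) (?F \<circ> ?R)"
    using f(2) by (intro arg_cong[where f = "distr _ _"]) (auto simp: fun_eq_iff)
  also have "\<dots> = distr (\<Pi>\<^sub>M k\<in>I. \<mu>) (\<Pi>\<^sub>M i\<in>UNIV. N) ?F"
    unfolding law[symmetric] by (rule distr_distr[OF F R, symmetric])
  also have "\<dots> = distr (\<Pi>\<^sub>M k\<in>I. \<mu>) (\<Pi>\<^sub>M i\<in>UNIV. \<mu>) ?F"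
    by (intro distr_cong sets_PiM_cong) (simp_all add: sets_\<mu>)
  also have "\<dots> = (\<Pi>\<^sub>M i\<in>UNIV. \<mu>)"
    using distr_PiM_reindex[of I "\<lambda>_. \<mu>" f UNIV] f prob_\<mu> by (auto simp: restrict_UNIV)
  finally show ?thesis .
qed

theorem theorem3p1:
  fixes M :: "'a measure" and Z :: "nat \<Rightarrow> 'a \<Rightarrow> real^2"
  assumes "prob_space M"
    and indep: "prob_space.indep_vars M (\<lambda>_. borel) Z {1..}"
    and ident: "\<forall>k\<ge>1. distr M borel (Z k) = distr M borel (Z 1)"
    and inradius: "AE \<omega> in M. filterlim (\<lambda>n. hull_inradius Z n \<omega>) at_top sequentially"
  shows "\<forall>A\<in>hull_tail M Z. measure M A \<in> {0, 1}"
proof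
  fix A assume A: "A \<in> hull_tail M Z"
  interpret prob_space M by fact
  define \<mu> where "\<mu> = distr M borel (Z 1)"
  define X where "X \<omega> i = Z (Suc i) \<omega>" for \<omega> i
  have X_eq: "X = (\<lambda>\<omega> i. Z (Suc i) \<omega>)"
    by (simp add: fun_eq_iff X_def)
  have rv: "Z k \<in> borel_measurable M" if "k \<ge> 1" for k
    using indep that by (simp add: indep_vars_def2)
  interpret \<mu>: prob_space \<mu>
    unfolding \<mu>_def by (rule prob_space_distr) (simp add: rv)
  interpret seq: sequence_space \<mu> ..
  let ?S = "\<Pi>\<^sub>M i\<in>(UNIV :: nat set). \<mu>"
  have sets_S: "sets ?S = sets (\<Pi>\<^sub>M i\<in>UNIV. borel)"
    by (rule sets_PiM_cong) (simp_all add: \<mu>_def)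
  have X: "X \<in> measurable M ?S"
    unfolding measurable_cong_sets[OF refl sets_S] X_def
    by (intro measurable_PiM_single') (auto intro: rv)
  have ident_\<mu>: "distr M borel (Z k) = \<mu>" if "k \<in> {1..}" for k
    unfolding \<mu>_def by (rule ident[rule_format]) (use that in simp)
  have "distr M (\<Pi>\<^sub>M i\<in>UNIV. borel) X = ?S"
    unfolding X_eq by (rule distr_iid_subsequence[OF indep _ inj_Suc]) (auto intro: ident_\<mu>)
  moreover have "distr M ?S X = distr M (\<Pi>\<^sub>M i\<in>UNIV. borel) X"
    by (rule distr_cong[OF refl sets_S refl])
  ultimately have distr_X: "distr M ?S X = ?S"
    by (rule trans[rotated])
  have AE_X: "AE \<omega> in M. Q (X \<omega>)" if "AE s in ?S. Q s" for Q
    using that X by (metis AE_distrD distr_X)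
  have "\<forall>m. \<exists>C. C \<in> sets ?S \<and> A = {\<omega> \<in> space M. X \<omega> \<in> C} \<and>
    (\<forall>s t. (\<forall>n\<ge>m. seq_hull n s = seq_hull n t) \<longrightarrow> s \<in> C \<longleftrightarrow> t \<in> C)"
    unfolding X_eq sets_S by (intro allI hull_tail_factorization[OF \<open>prob_space M\<close> A])
  then have "\<exists>C. \<forall>m. C m \<in> sets ?S \<and> A = {\<omega> \<in> space M. X \<omega> \<in> C m} \<and>
    (\<forall>s t. (\<forall>n\<ge>m. seq_hull n s = seq_hull n t) \<longrightarrow> s \<in> C m \<longleftrightarrow> t \<in> C m)"
    by (rule choice)
  then obtain C where C: "C m \<in> sets ?S" "A = {\<omega> \<in> space M. X \<omega> \<in> C m}"
    and C_hull: "\<forall>n\<ge>m. seq_hull n s = seq_hull n t \<Longrightarrow> s \<in> C m \<longleftrightarrow> t \<in> C m" for m s t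
    by blast
  have C_eq: "AE s in ?S. \<forall>m. s \<in> C m \<longleftrightarrow> s \<in> C 0"
  proof -
    have "AE s in distr M ?S X. s \<in> C m \<longleftrightarrow> s \<in> C 0" for m
    proof (subst AE_distr_iff[OF X])
      show "{s \<in> space ?S. s \<in> C m \<longleftrightarrow> s \<in> C 0} \<in> sets ?S"
        using C(1) by measurable
      show "AE \<omega> in M. X \<omega> \<in> C m \<longleftrightarrow> X \<omega> \<in> C 0"
        using C(2)[of m] C(2)[of 0] by (intro AE_I2) blast
    qed
    then show ?thesis
      unfolding distr_X AE_all_countable by blast
  qed
  have "measure ?S (C 0) \<in> {0, 1}"
  proof (rule seq.hewitt_savage_zero_one[OF C(1)])
    fix k and \<pi> :: "nat \<Rightarrow> nat" assume \<pi>: "\<pi> permutes {..<k}"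
    \<comment> \<open>The permuted sequence has the same law, so the null set outside which all the \<open>C m\<close> agree
      is avoided by it as well.\<close>
    have C_eq': "AE s in ?S. \<forall>m. s \<circ> \<pi> \<in> C m \<longleftrightarrow> s \<circ> \<pi> \<in> C 0"
    proof (rule AE_distrD[OF seq.measurable_permute])
      show "AE s in distr ?S ?S (\<lambda>s. s \<circ> \<pi>). \<forall>m. s \<in> C m \<longleftrightarrow> s \<in> C 0"
        unfolding seq.distr_permute[OF permutes_inj[OF \<pi>]] by (rule C_eq)
    qed
    have "AE \<omega> in M. X \<omega> \<in> C 0 \<longleftrightarrow> X \<omega> \<circ> \<pi> \<in> C 0"
      using inradius AE_X[OF C_eq] AE_X[OF C_eq']
    proof eventually_elim
      case (elim \<omega>)
      \<comment> \<open>This \<open>m\<close> depends on the outcome, which is why the sets \<open>C m\<close> are needed for all \<open>m\<close>.\<close>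
      obtain m where "\<forall>n\<ge>m. seq_hull n (X \<omega> \<circ> \<pi>) = seq_hull n (X \<omega>)"
        using eventually_seq_hull_permute[OF \<pi> elim(1)]
        unfolding X_def eventually_sequentially by blast
      then have "X \<omega> \<circ> \<pi> \<in> C m \<longleftrightarrow> X \<omega> \<in> C m"
        by (rule C_hull)
      then show ?case
        using elim(2,3) by blast
    qed
    moreover have "{s \<in> space ?S. s \<in> C 0 \<longleftrightarrow> s \<circ> \<pi> \<in> C 0} \<in> sets ?S"
    proof -
      have "{s \<in> space ?S. s \<circ> \<pi> \<in> C 0} \<in> sets ?S"
        using measurable_sets[OF seq.measurable_permute C(1)] by (simp add: vimage_def Int_def conj_commute)
      then show ?thesis
        using C(1)[of 0] by measurable
    qed
    ultimately have "AE s in distr M ?S X. s \<in> C 0 \<longleftrightarrow> s \<circ> \<pi> \<in> C 0"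
      by (subst AE_distr_iff[OF X])
    then show "AE s in ?S. s \<in> C 0 \<longleftrightarrow> s \<circ> \<pi> \<in> C 0"
      unfolding distr_X .
  qed
  moreover have "measure ?S (C 0) = measure M A"
    using measure_distr[OF X C(1)[of 0]] C(2)[of 0] unfolding distr_X
    by (simp add: vimage_def Int_def conj_commute)
  ultimately show "measure M A \<in> {0, 1}"
    by simp
qed

end
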